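(* For $n\ge0$ let $e_n$ be the number of evenly tagged polydiagonal subspaces of $\mathbb{R}^n$. The exponential generating function of $(e_n)$ is $$E(x)=\sum_{n=0}^\infty e_n\frac{x^n}{n!}=e^{I_0(2x)/2-1/2+x},$$ where $I_0$ is the modified Bessel function of the first kind.
   Context: A partial involution on a set $X$ is a map $x\mapsto x^*:\tilde X\to\tilde X$ defined on a (possibly empty) subset $\tilde X\subseteq X$ that is its own inverse. A tagged partition of a finite set $C$ is a partition $\mathcal{P}$ of $C$ (into nonempty classes) together with a partial involution $P\mapsto P^*$ on $\mathcal{P}$ that has at most one fixed point. The class of $i$ is denoted by $[i]$. For a tagged partition $\mathcal{P}$ of $\{1,\ldots,n\}$, the polydiagonal subspace is $$\Delta_{\mathcal{P}}=\{x\in\mathbb{R}^n\mid x_i=x_j\text{ if }[i]=[j],\text{ and }x_i=-x_j\text{ if }[i]^*=[j]\},$$ and $\mathcal{P}\mapsto\Delta_{\mathcal{P}}$ is a bijection from tagged partitions of $\{1,\ldots,n\}$ to polydiagonal subspaces of $\mathbb{R}^n$. For $n=0$ the only tagged partition is the empty one (with empty partial involution), which is fully and evenly tagged. $\Delta_{\mathcal{P}}$ is fully tagged if the partial involution is defined on all of $\mathcal{P}$, and evenly tagged if it is fully tagged and $\#P=\#P^*$ for all $P\in\mathcal{P}$. Exponential generating functions are formal power series, and $I_0(2x)=\sum_{m=0}^\infty\binom{2m}{m}\frac{x^{2m}}{(2m)!}=\sum_{m=0}^\infty\frac{x^{2m}}{(m!)^2}$. *)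

theory Defs
  imports
    Complex_Main
    "HOL-Library.Disjoint_Sets"
    "HOL-Computational_Algebra.Formal_Power_Series"
begin

(* A partial involution is a partial map s, with s x = Some y for x^* = y on its domain of definition. *)
definition partial_involution_on :: "'a set \<Rightarrow> ('a \<rightharpoonup> 'a) \<Rightarrow> bool" where
  "partial_involution_on X s \<longleftrightarrow>
     dom s \<subseteq> X \<and> ran s \<subseteq> dom s \<and> (\<forall>x y. s x = Some y \<longrightarrow> s y = Some x)"

definition tagged_partition :: "'a set \<Rightarrow> 'a set set \<Rightarrow> ('a set \<rightharpoonup> 'a set) \<Rightarrow> bool" where
  "tagged_partition C \<P> s \<longleftrightarrow>
     finite C \<and> partition_on C \<P> \<and> partial_involution_on \<P> s \<and> (\<exists>\<^sub>\<le>\<^sub>1 P. s P = Some P)"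

definition class_of :: "'a set set \<Rightarrow> 'a \<Rightarrow> 'a set" where
  "class_of \<P> i = (THE P. P \<in> \<P> \<and> i \<in> P)"

(* Since n varies, a vector in R^n is a function on nat with coordinates at the indices 1..n,
   normalised to be 0 at all other indices. *)
definition real_space :: "nat \<Rightarrow> (nat \<Rightarrow> real) set" where
  "real_space n = {x. \<forall>i. i \<notin> {1..n} \<longrightarrow> x i = 0}"

definition polydiagonal ::
    "nat \<Rightarrow> nat set set \<Rightarrow> (nat set \<rightharpoonup> nat set) \<Rightarrow> (nat \<Rightarrow> real) set" where
  "polydiagonal n \<P> s =
     {x \<in> real_space n. \<forall>i\<in>{1..n}. \<forall>j\<in>{1..n}.
        (class_of \<P> i = class_of \<P> j \<longrightarrow> x i = x j) \<and>
        (s (class_of \<P> i) = Some (class_of \<P> j) \<longrightarrow> x i = - x j)}"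

definition fully_tagged :: "'a set set \<Rightarrow> ('a set \<rightharpoonup> 'a set) \<Rightarrow> bool" where
  "fully_tagged \<P> s \<longleftrightarrow> dom s = \<P>"

definition evenly_tagged :: "'a set set \<Rightarrow> ('a set \<rightharpoonup> 'a set) \<Rightarrow> bool" where
  "evenly_tagged \<P> s \<longleftrightarrow> fully_tagged \<P> s \<and> (\<forall>P\<in>\<P>. card P = card (the (s P)))"

(* The property of a subspace does not depend on the choice of tagged partition below, because
   a polydiagonal subspace determines its tagged partition. *)
definition evenly_tagged_polydiagonals :: "nat \<Rightarrow> (nat \<Rightarrow> real) set set" where
  "evenly_tagged_polydiagonals n =
     {polydiagonal n \<P> s | \<P> s. tagged_partition {1..n} \<P> s \<and> evenly_tagged \<P> s}"

definition num_evenly_tagged :: "nat \<Rightarrow> nat" where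
  "num_evenly_tagged n = card (evenly_tagged_polydiagonals n)"

definition egf :: "(nat \<Rightarrow> nat) \<Rightarrow> real fps" where
  "egf a = Abs_fps (\<lambda>n. of_nat (a n) / fact n)"

(* I_0(z) = sum over m of (z/2)^(2m) / (m!)^2, as a formal power series in z. *)
definition bessel_I0 :: "real fps" where
  "bessel_I0 = Abs_fps (\<lambda>k. if even k then (1/2) ^ k / (fact (k div 2))\<^sup>2 else 0)"

lemma bessel_I0_double_nth:
  "fps_nth (bessel_I0 oo (fps_const 2 * fps_X)) k =
     (if even k then 1 / (fact (k div 2))\<^sup>2 else 0)"
  by (simp add: bessel_I0_def fps_compose_linear power_one_over)

lemma bessel_I0_double_nth_even:
  "fps_nth (bessel_I0 oo (fps_const 2 * fps_X)) (2 * m) = of_nat ((2 * m) choose m) / fact (2 * m)"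
  unfolding bessel_I0_double_nth by (simp add: binomial_fact power2_eq_square)

end

(* An evenly tagged partition is a possibly empty fixed class together with unordered pairs {P, P^*}
   of classes of equal size. Removing the last point from the structures on n+1 points either shrinks
   the fixed class, or destroys a pair (A + point, B) with card B = card A + 1 and leaves a structure
   on n - 2 card A - 1 points. The resulting recurrence for e_n is the coefficient form of
   E' = E (1 + G'), where G = (I_0(2x) - 1) / 2. *)

theory Submission
  imports Defs
begin

unbundle fps_syntax

section \<open>Pairings and the subspaces they determine\<close>

(* R is the graph of the involution on the classes that it does not fix; the fixed class is the
   complement in C of their union, so that an absent fixed class is just an empty one. *)
definition pairing :: "'a set \<Rightarrow> ('a set \<times> 'a set) set \<Rightarrow> bool" where
  "pairing C R \<longleftrightarrow>
     (\<forall>P Q. (P, Q) \<in> R \<longrightarrow>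
        (Q, P) \<in> R \<and> P \<noteq> {} \<and> P \<subseteq> C \<and> P \<inter> Q = {} \<and> card P = card Q) \<and>
     (\<forall>P Q P' Q'. (P, Q) \<in> R \<longrightarrow> (P', Q') \<in> R \<longrightarrow> P \<inter> P' \<noteq> {} \<longrightarrow> P = P' \<and> Q = Q')"

text \<open>The equation x = -x on a fixed class forces 0 there, just as the normalisation does at
  indices outside the ambient set. A single vanishing condition off the paired classes covers both,
  so the space depends on \<open>R\<close> alone.\<close>

definition pairing_space :: "('a set \<times> 'a set) set \<Rightarrow> ('a \<Rightarrow> real) set" where
  "pairing_space R =
     {x. (\<forall>i. i \<notin> \<Union> (Domain R) \<longrightarrow> x i = 0) \<and>
         (\<forall>(P, Q)\<in>R. \<forall>i\<in>P. (\<forall>j\<in>P. x i = x j) \<and> (\<forall>j\<in>Q. x i = - x j))}"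

lemma pairingD:
  assumes "pairing C R" "(P, Q) \<in> R"
  shows "(Q, P) \<in> R" "P \<noteq> {}" "Q \<noteq> {}" "P \<subseteq> C" "Q \<subseteq> C" "P \<inter> Q = {}" "card P = card Q"
  using assms unfolding pairing_def by blast+

lemma pairing_unique:
  assumes "pairing C R" "(P, Q) \<in> R" "(P', Q') \<in> R" "i \<in> P" "i \<in> P'"
  shows "P = P'" "Q = Q'"
  using assms unfolding pairing_def by blast+

lemma pairing_spaceI:
  assumes "\<And>i. i \<notin> \<Union> (Domain R) \<Longrightarrow> x i = 0"
    and "\<And>P Q i j. (P, Q) \<in> R \<Longrightarrow> i \<in> P \<Longrightarrow> j \<in> P \<Longrightarrow> x i = x j"
    and "\<And>P Q i j. (P, Q) \<in> R \<Longrightarrow> i \<in> P \<Longrightarrow> j \<in> Q \<Longrightarrow> x i = - x j"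
  shows "x \<in> pairing_space R"
  using assms unfolding pairing_space_def by blast

lemma pairing_spaceD:
  assumes "x \<in> pairing_space R"
  shows "i \<notin> \<Union> (Domain R) \<Longrightarrow> x i = 0"
    and "(P, Q) \<in> R \<Longrightarrow> i \<in> P \<Longrightarrow> j \<in> P \<Longrightarrow> x i = x j"
    and "(P, Q) \<in> R \<Longrightarrow> i \<in> P \<Longrightarrow> j \<in> Q \<Longrightarrow> x i = - x j"
  using assms unfolding pairing_space_def by blast+

text \<open>Distinct classes of \<open>R\<close> are disjoint, so the vector is constant on each of
  them and takes nonzero values only on \<open>P\<close> and its partner \<open>Q\<close>. It serves
  as the witness that tells \<open>P\<close> and \<open>Q\<close> apart from all other
  coordinates.\<close>

lemma sign_vector_in_pairing_space:
  assumes R: "pairing C R" and PQ: "(P, Q) \<in> R"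
  shows "(\<lambda>i. if i \<in> P then 1 else if i \<in> Q then - 1 else 0) \<in> pairing_space R"
proof -
  note QP = pairingD(1)[OF R PQ]
  have PQ_neq: "P \<noteq> Q" using pairingD(2,6)[OF R PQ] by blast
  have P: "i \<in> P \<longleftrightarrow> A = P \<and> B = Q" if "(A, B) \<in> R" "i \<in> A" for A B i
    using pairing_unique[OF R that(1) PQ that(2)] that by blast
  have Q: "i \<in> Q \<longleftrightarrow> A = Q \<and> B = P" if "(A, B) \<in> R" "i \<in> A" for A B i
    using pairing_unique[OF R that(1) QP that(2)] that by blast
  show ?thesis
  proof (rule pairing_spaceI)
    fix A B i j assume A: "(A, B) \<in> R" "i \<in> A" "j \<in> B"
    note B = pairingD(1)[OF R A(1)]
    show "(if i \<in> P then 1 else if i \<in> Q then - 1 else 0 :: real) =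
        - (if j \<in> P then 1 else if j \<in> Q then - 1 else 0)"
      unfolding P[OF A(1,2)] Q[OF A(1,2)] P[OF B A(3)] Q[OF B A(3)] using PQ_neq by auto
  next
    fix A B i j assume A: "(A, B) \<in> R" "i \<in> A" "j \<in> A"
    show "(if i \<in> P then 1 else if i \<in> Q then - 1 else 0 :: real) =
        (if j \<in> P then 1 else if j \<in> Q then - 1 else 0)"
      using P[OF A(1,2)] Q[OF A(1,2)] P[OF A(1,3)] Q[OF A(1,3)] by simp
  qed (use PQ QP in auto)
qed

(* The sign vectors separate the classes, so a class is recovered as the set of coordinates that
   agree with a given nonvanishing one throughout the space. *)
lemma pairing_eq_of_space:
  assumes R: "pairing C R"
  shows "R = {(P, Q). \<exists>a. (\<exists>x\<in>pairing_space R. x a \<noteq> 0) \<and>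
    P = {j. \<forall>x\<in>pairing_space R. x j = x a} \<and> Q = {j. \<forall>x\<in>pairing_space R. x j = - x a}}"
    (is "R = {(P, Q). ?rel P Q}")
proof -
  have classes: "(\<exists>x\<in>pairing_space R. x a \<noteq> 0) \<and> {j. \<forall>x\<in>pairing_space R. x j = x a} = P \<and>
    {j. \<forall>x\<in>pairing_space R. x j = - x a} = Q" if PQ: "(P, Q) \<in> R" and a: "a \<in> P" for P Q a
  proof -
    note QP = pairingD(1)[OF R PQ]
    define v where "v i = (if i \<in> P then 1 else if i \<in> Q then - 1 else 0 :: real)" for i
    have v: "v \<in> pairing_space R"
      using sign_vector_in_pairing_space[OF R PQ] unfolding v_def .
    have va: "v a = 1" using a by (simp add: v_def)
    have 1: "j \<in> P" if "\<forall>x\<in>pairing_space R. x j = x a" for j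
    proof -
      have "v j = 1" using that v va by auto
      then show ?thesis by (auto simp: v_def split: if_splits)
    qed
    have 2: "j \<in> Q" if "\<forall>x\<in>pairing_space R. x j = - x a" for j
    proof -
      have "v j = - 1" using that v va by auto
      then show ?thesis by (auto simp: v_def split: if_splits)
    qed
    have 3: "x j = x a" if "j \<in> P" "x \<in> pairing_space R" for x j
      using pairing_spaceD(2)[OF that(2) PQ that(1) a] .
    have 4: "x j = - x a" if "j \<in> Q" "x \<in> pairing_space R" for x j
      using pairing_spaceD(3)[OF that(2) QP that(1) a] .
    show ?thesis
      using v va 1 2 3 4 by (intro conjI bexI[of _ v] equalityI subsetI) auto
  qed
  have "?rel P Q" if PQ: "(P, Q) \<in> R" for P Q
  proof -
    obtain a where "a \<in> P" using pairingD(2)[OF R PQ] by blast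
    from classes[OF PQ this] show ?thesis by blast
  qed
  moreover have "(P, Q) \<in> R" if rel: "?rel P Q" for P Q
  proof -
    from rel obtain a x where a: "x \<in> pairing_space R" "x a \<noteq> 0"
      "P = {j. \<forall>x\<in>pairing_space R. x j = x a}" "Q = {j. \<forall>x\<in>pairing_space R. x j = - x a}"
      by blast
    \<comment> \<open>Vectors of the space vanish off the paired classes, so
      \<open>x a \<noteq> 0\<close> places \<open>a\<close> in some class of
      \<open>R\<close>.\<close>
    obtain A B where "(A, B) \<in> R" "a \<in> A" using pairing_spaceD(1)[OF a(1), of a] a(2) by blast
    with classes[OF this] a show ?thesis by simp
  qed
  ultimately have "(P, Q) \<in> R \<longleftrightarrow> ?rel P Q" for P Q by (rule iffI)
  then show ?thesis
    by (intro set_eqI) (simp only: split_paired_all mem_Collect_eq prod.case)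
qed

text \<open>The description of \<open>R\<close> in \<open>pairing_eq_of_space\<close> mentions
  \<open>R\<close> only through its space. Counting spaces thereby becomes counting
  pairings.\<close>

lemma inj_on_pairing_space: "inj_on pairing_space {R. pairing C R}"
proof (rule inj_onI, clarsimp)
  fix R R' :: "('a set \<times> 'a set) set"
  assume "pairing C R" "pairing C R'" "pairing_space R = pairing_space R'"
  then show "R = R'"
    using pairing_eq_of_space[of C R] pairing_eq_of_space[of C R'] by simp
qed

section \<open>Evenly tagged partitions correspond to pairings\<close>

lemma class_of_eq:
  assumes "partition_on C \<P>" "P \<in> \<P>" "i \<in> P"
  shows "class_of \<P> i = P"
  unfolding class_of_def
proof (rule the_equality)
  fix Q assume "Q \<in> \<P> \<and> i \<in> Q"
  then show "Q = P" using assms by (auto simp: partition_on_def disjoint_def)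
qed (use assms in auto)

text \<open>When every class is tagged, a class either has a different partner, which gives the
  equations of the pairing space, or is fixed, which forces its coordinates to vanish.\<close>

lemma polydiagonal_eq_pairing_space:
  assumes part: "partition_on {1..n} \<P>" and dom: "dom s = \<P>" and ran: "ran s \<subseteq> \<P>"
  shows "polydiagonal n \<P> s = pairing_space {(P, Q). s P = Some Q \<and> P \<noteq> Q}"
    (is "_ = pairing_space ?R")
proof (intro equalityI subsetI)
  note cl = class_of_eq[OF part]
  have cover: "\<exists>P Q. P \<in> \<P> \<and> i \<in> P \<and> s P = Some Q \<and> Q \<in> \<P>" if i: "i \<in> {1..n}" for i
  proof -
    obtain P where P: "P \<in> \<P>" "i \<in> P" using i partition_onD1[OF part] by blast
    then obtain Q where "s P = Some Q" using dom by blast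
    with P ran show ?thesis by (auto simp: ran_def)
  qed
  have sub: "i \<in> {1..n}" if "P \<in> \<P>" "i \<in> P" for i P
    using that part by (auto simp: partition_on_def)
  {
    fix x assume x: "x \<in> polydiagonal n \<P> s"
    then have supp: "x i = 0" if "i \<notin> {1..n}" for i
      using that by (auto simp: polydiagonal_def real_space_def)
    have same: "x i = x j" if "P \<in> \<P>" "i \<in> P" "j \<in> P" for P i j
      using x sub that cl unfolding polydiagonal_def by auto
    have opp: "x i = - x j" if "s P = Some Q" "i \<in> P" "j \<in> Q" for P Q i j
    proof -
      have "P \<in> \<P>" "Q \<in> \<P>" using that dom ran by (auto simp: ran_def)
      then show ?thesis using x sub that cl unfolding polydiagonal_def by auto
    qed
    show "x \<in> pairing_space ?R"
    proof (rule pairing_spaceI)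
      fix i assume i: "i \<notin> \<Union> (Domain ?R)"
      show "x i = 0"
      proof (cases "i \<in> {1..n}")
        case True
        then obtain P Q where PQ: "P \<in> \<P>" "i \<in> P" "s P = Some Q" using cover by blast
        \<comment> \<open>An index in no paired class lies in a fixed class; taking
          \<open>opp\<close> with both indices equal to \<open>i\<close> then gives x i = - x
          i.\<close>
        with i have "P = Q" by auto
        with opp[OF PQ(3,2), of i] PQ show ?thesis by simp
      qed (rule supp)
    qed (use same opp dom in auto)
  next
    fix x assume x: "x \<in> pairing_space ?R"
    \<comment> \<open>Classes of the partition are disjoint, so an index of a fixed class lies in no
      class of \<open>Domain ?R\<close>.\<close>
    have fixed: "x i = 0" if "s P = Some P" "i \<in> P" for P i
    proof (rule pairing_spaceD(1)[OF x])
      show "i \<notin> \<Union> (Domain ?R)"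
      proof
        assume "i \<in> \<Union> (Domain ?R)"
        then obtain P' Q where "s P' = Some Q" "P' \<noteq> Q" "i \<in> P'" by auto
        moreover from this have "P' = P" using that dom cl[of P i] cl[of P' i] by auto
        ultimately show False using that by simp
      qed
    qed
    have "x i = 0" if "i \<notin> {1..n}" for i
      using sub dom that by (intro pairing_spaceD(1)[OF x]) auto
    moreover have "x i = x j" if ij: "i \<in> {1..n}" "j \<in> {1..n}" "class_of \<P> i = class_of \<P> j" for i j
    proof -
      obtain P Q where P: "P \<in> \<P>" "i \<in> P" "s P = Some Q" using cover[OF ij(1)] by blast
      moreover obtain P' where P': "P' \<in> \<P>" "j \<in> P'" using cover[OF ij(2)] by blast
      ultimately have "j \<in> P" using cl[OF P(1,2)] cl[OF P'] ij by simp
      show ?thesis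
      proof (cases "P = Q")
        case True
        with fixed P \<open>j \<in> P\<close> show ?thesis by simp
      next
        case False
        with P \<open>j \<in> P\<close> show ?thesis by (intro pairing_spaceD(2)[OF x, of P Q]) auto
      qed
    qed
    moreover have "x i = - x j"
      if ij: "i \<in> {1..n}" "j \<in> {1..n}" "s (class_of \<P> i) = Some (class_of \<P> j)" for i j
    proof -
      obtain P where P: "P \<in> \<P>" "i \<in> P" using cover[OF ij(1)] by blast
      moreover obtain Q where Q: "Q \<in> \<P>" "j \<in> Q" using cover[OF ij(2)] by blast
      ultimately have PQ: "s P = Some Q" using cl[OF P] cl[OF Q] ij by simp
      show ?thesis
      proof (cases "P = Q")
        case True
        with fixed P Q PQ show ?thesis by simp
      next
        case False
        with P Q PQ show ?thesis by (intro pairing_spaceD(3)[OF x, of P Q]) auto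
      qed
    qed
    ultimately show "x \<in> polydiagonal n \<P> s"
      unfolding polydiagonal_def real_space_def by blast
  }
qed

lemma pairing_of_evenly_tagged:
  assumes tag: "tagged_partition C \<P> s" and even: "evenly_tagged \<P> s"
  shows "pairing C {(P, Q). s P = Some Q \<and> P \<noteq> Q}"
proof -
  have part: "partition_on C \<P>" and inv: "partial_involution_on \<P> s"
    using tag by (auto simp: tagged_partition_def)
  have dom: "dom s = \<P>" and card: "\<And>P. P \<in> \<P> \<Longrightarrow> card P = card (the (s P))"
    using even by (auto simp: evenly_tagged_def fully_tagged_def)
  have sym: "s Q = Some P" if "s P = Some Q" for P Q
    using inv that unfolding partial_involution_on_def by blast
  have in_part: "P \<in> \<P>" if "s P = Some Q" for P Q
    using dom that by auto
  have disj: "P = Q" if "P \<in> \<P>" "Q \<in> \<P>" "P \<inter> Q \<noteq> {}" for P Q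
    using part that by (auto simp: partition_on_def disjoint_def)
  have nonempty: "P \<noteq> {} \<and> P \<subseteq> C" if "P \<in> \<P>" for P
    using part that by (auto simp: partition_on_def)
  show ?thesis
    unfolding pairing_def
  proof (intro conjI allI impI)
    fix P Q assume "(P, Q) \<in> {(P, Q). s P = Some Q \<and> P \<noteq> Q}"
    then have PQ: "s P = Some Q" "P \<noteq> Q" by auto
    then show "(Q, P) \<in> {(P, Q). s P = Some Q \<and> P \<noteq> Q}" using sym[OF PQ(1)] by simp
    show "P \<noteq> {}" "P \<subseteq> C" using nonempty in_part[OF PQ(1)] by auto
    show "P \<inter> Q = {}" using disj in_part[OF PQ(1)] in_part[OF sym[OF PQ(1)]] PQ by blast
    show "card P = card Q" using card[OF in_part[OF PQ(1)]] PQ by simp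
  next
    fix P Q P' Q'
    assume "(P, Q) \<in> {(P, Q). s P = Some Q \<and> P \<noteq> Q}"
      "(P', Q') \<in> {(P, Q). s P = Some Q \<and> P \<noteq> Q}" and ne: "P \<inter> P' \<noteq> {}"
    then have PQ: "s P = Some Q" "s P' = Some Q'" by auto
    show "P = P'" using disj[OF in_part[OF PQ(1)] in_part[OF PQ(2)] ne] .
    then show "Q = Q'" using PQ by simp
  qed
qed

text \<open>The involution is rebuilt by swapping partners and fixing the complement of all paired
  classes. Only this complement can be fixed, which gives the bound of one fixed point.\<close>

lemma evenly_tagged_of_pairing:
  assumes fin: "finite C" and R: "pairing C R"
  shows "\<exists>\<P> s. tagged_partition C \<P> s \<and> evenly_tagged \<P> s \<and> R = {(P, Q). s P = Some Q \<and> P \<noteq> Q}"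
proof -
  define Z where "Z = C - \<Union> (Domain R)"
  \<comment> \<open>Classes of a partition are nonempty, so \<open>Z\<close> is dropped when it is
    empty.\<close>
  define \<P> where "\<P> = Domain R \<union> ({Z} - {{}})"
  define s where "s P = (if P \<in> Domain R then Some (THE Q. (P, Q) \<in> R)
    else if P = Z \<and> Z \<noteq> {} then Some Z else None)" for P
  have sR: "s P = Some Q" if "(P, Q) \<in> R" for P Q
  proof -
    have "(THE Q. (P, Q) \<in> R) = Q"
      \<comment> \<open>\<open>P\<close> has an element, and a class of \<open>R\<close> through a
        given element determines its partner.\<close>
      using pairing_unique[OF R that] pairingD(2)[OF R that] that by (intro the_equality) blast+
    with that show ?thesis by (auto simp: s_def)
  qed
  have ZR: "Z \<notin> Domain R" if "Z \<noteq> {}"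
    using that by (auto simp: Z_def)
  have s_iff: "s P = Some Q \<longleftrightarrow> (P, Q) \<in> R \<or> (P = Z \<and> Q = Z \<and> Z \<noteq> {})" for P Q
  proof (cases "P \<in> Domain R")
    case True
    then obtain Q' where Q': "(P, Q') \<in> R" by blast
    have "(P, Q) \<in> R \<longleftrightarrow> Q = Q'" using sR[of P Q] sR[OF Q'] Q' by auto
    then show ?thesis using sR[OF Q'] ZR True by auto
  qed (auto simp: s_def)
  have dom: "dom s = \<P>" by (auto simp: dom_def s_def \<P>_def)
  have part: "partition_on C \<P>"
    unfolding partition_on_def disjoint_def
  proof (intro conjI ballI impI)
    have "P \<subseteq> C" if "P \<in> Domain R" for P
      using that R unfolding pairing_def by blast
    then have "\<Union> (Domain R) \<subseteq> C" by (rule Sup_least)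
    moreover have "\<Union> \<P> = \<Union> (Domain R) \<union> Z"
      unfolding \<P>_def by (cases "Z = {}") (simp_all add: Un_commute)
    ultimately show "\<Union> \<P> = C" unfolding Z_def by (simp add: Un_absorb1)
    have "{} \<notin> Domain R" using R unfolding pairing_def by blast
    then show "{} \<notin> \<P>" unfolding \<P>_def by blast
    fix P Q assume PQ: "P \<in> \<P>" "Q \<in> \<P>" "P \<noteq> Q"
    have "P \<inter> Q = {}" if "P \<in> Domain R" "Q \<in> Domain R"
      using R that PQ(3) unfolding pairing_def by blast
    with PQ show "P \<inter> Q = {}" by (auto simp: \<P>_def Z_def)
  qed
  have sym: "s Q = Some P" if "s P = Some Q" for P Q
    using that pairingD(1)[OF R] by (auto simp: s_iff)
  have irrefl: "P \<noteq> Q" if "(P, Q) \<in> R" for P Q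
    using pairingD(2,6)[OF R that] by blast
  have "tagged_partition C \<P> s"
    unfolding tagged_partition_def partial_involution_on_def
  proof (intro conjI fin part allI impI)
    show "dom s \<subseteq> \<P>" using dom by simp
    show "ran s \<subseteq> dom s" using sym unfolding ran_def dom_def by blast
    show "\<exists>\<^sub>\<le>\<^sub>1 P. s P = Some P" using irrefl by (auto simp: Uniq_def s_iff)
  qed (rule sym)
  moreover have "evenly_tagged \<P> s"
    unfolding evenly_tagged_def fully_tagged_def
  proof (intro conjI dom ballI)
    fix P assume "P \<in> \<P>"
    then obtain Q where Q: "s P = Some Q" using dom by blast
    then have "card P = card Q" using pairingD(7)[OF R, of P Q] unfolding s_iff by blast
    with Q show "card P = card (the (s P))" by simp
  qed
  moreover have "R = {(P, Q). s P = Some Q \<and> P \<noteq> Q}"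
    using irrefl by (auto simp: s_iff)
  ultimately show ?thesis by blast
qed

lemma evenly_tagged_polydiagonals_eq:
  "evenly_tagged_polydiagonals n = pairing_space ` {R. pairing {1..n} R}"
proof -
  have eq: "polydiagonal n \<P> s = pairing_space {(P, Q). s P = Some Q \<and> P \<noteq> Q}"
    if "tagged_partition {1..n} \<P> s" "evenly_tagged \<P> s" for \<P> s
  proof (rule polydiagonal_eq_pairing_space)
    show "partition_on {1..n} \<P>" using that by (simp add: tagged_partition_def)
    show dom: "dom s = \<P>" using that by (simp add: evenly_tagged_def fully_tagged_def)
    have "ran s \<subseteq> dom s" using that by (simp add: tagged_partition_def partial_involution_on_def)
    with dom show "ran s \<subseteq> \<P>" by simp
  qed
  show ?thesis
  proof (intro equalityI subsetI)
    fix D assume "D \<in> evenly_tagged_polydiagonals n"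
    then show "D \<in> pairing_space ` {R. pairing {1..n} R}"
      using eq pairing_of_evenly_tagged unfolding evenly_tagged_polydiagonals_def by blast
  next
    fix D assume "D \<in> pairing_space ` {R. pairing {1..n} R}"
    then obtain R where R: "pairing {1..n} R" "D = pairing_space R" by auto
    obtain \<P> s where "tagged_partition {1..n} \<P> s" "evenly_tagged \<P> s"
      "R = {(P, Q). s P = Some Q \<and> P \<noteq> Q}"
      using evenly_tagged_of_pairing[OF finite_atLeastAtMost R(1)] by blast
    with R eq show "D \<in> evenly_tagged_polydiagonals n"
      unfolding evenly_tagged_polydiagonals_def by blast
  qed
qed

lemma num_evenly_tagged_eq: "num_evenly_tagged n = card {R. pairing {1..n} R}"
  unfolding num_evenly_tagged_def evenly_tagged_polydiagonals_eq
  by (rule card_image[OF inj_on_pairing_space])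

section \<open>Recurrence for the number of pairings\<close>

lemma finite_pairings: "finite C \<Longrightarrow> finite {R. pairing C R}"
  by (rule finite_subset[of _ "Pow (Pow C \<times> Pow C)"]) (auto dest: pairingD(4,5))

lemma pairing_mono: "pairing C R \<Longrightarrow> C \<subseteq> D \<Longrightarrow> pairing D R"
  unfolding pairing_def by blast

text \<open>All classes of \<open>R\<close> avoid \<open>P\<close> and \<open>Q\<close>, so the new
  pair meets no old class. Both orientations are inserted because the relation is symmetric.\<close>

lemma pairing_add:
  assumes R: "pairing (C - P - Q) R" and ne: "P \<noteq> {}" "Q \<noteq> {}"
    and sub: "P \<subseteq> C" "Q \<subseteq> C" and dis: "P \<inter> Q = {}" and card: "card P = card Q"
  shows "pairing C (insert (P, Q) (insert (Q, P) R))" (is "pairing C ?R")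
proof -
  have R_sub: "A \<subseteq> C - P - Q" if "(A, B) \<in> R" for A B
    using pairingD(4)[OF R that] .
  show ?thesis
    unfolding pairing_def
  proof (intro conjI allI impI)
    fix A B assume AB: "(A, B) \<in> ?R"
    then consider "A = P" "B = Q" | "A = Q" "B = P" | "(A, B) \<in> R" by blast
    note cases = this
    show "(B, A) \<in> ?R" using cases by cases (simp_all add: pairingD(1)[OF R])
    show "A \<noteq> {}" using cases by cases (simp_all add: ne pairingD(2)[OF R])
    show "A \<subseteq> C" using cases R_sub[of A B] by cases (use sub in blast)+
    show "A \<inter> B = {}" using cases by cases (simp_all add: dis Int_commute pairingD(6)[OF R])
    show "card A = card B" using cases by cases (simp_all add: card pairingD(7)[OF R])
  next
    fix A B A' B' assume AB: "(A, B) \<in> ?R" "(A', B') \<in> ?R" and int: "A \<inter> A' \<noteq> {}"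
    have 1: "A = A' \<and> B = B'" if "(A, B) \<in> R" "(A', B') \<in> R"
      using R that int unfolding pairing_def by meson
    \<comment> \<open>Two classes that meet are thus either both old or both new.\<close>
    have 2: "(A, B) \<notin> R" if "A' = P \<or> A' = Q" using R_sub[of A B] that int by blast
    have 3: "(A', B') \<notin> R" if "A = P \<or> A = Q" using R_sub[of A' B'] that int by blast
    have 4: "A = A'" if "A = P \<or> A = Q" "A' = P \<or> A' = Q" using that int dis by blast
    show "A = A'" using AB 1 2 3 4 by blast
    show "B = B'" using AB 1 2 3 4 dis ne by blast
  qed
qed

text \<open>By uniqueness of the class through a point, every other pair is disjoint from
  \<open>P\<close> and \<open>Q\<close>. This undoes \<open>pairing_add\<close>.\<close>

lemma pairing_remove:
  assumes R: "pairing C R" and PQ: "(P, Q) \<in> R"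
  shows "pairing (C - P - Q) (R - {(P, Q), (Q, P)})" (is "pairing _ ?R")
proof -
  note QP = pairingD(1)[OF R PQ]
  have sub: "A \<subseteq> C - P - Q" if "(A, B) \<in> ?R" for A B
  proof -
    have AB: "(A, B) \<in> R" using that by simp
    have "A \<inter> P = {}" using pairing_unique[OF R AB PQ] that by blast
    moreover have "A \<inter> Q = {}" using pairing_unique[OF R AB QP] that by blast
    ultimately show ?thesis using pairingD(4)[OF R AB] by blast
  qed
  show ?thesis
    unfolding pairing_def
  proof (intro conjI allI impI)
    fix A B assume AB: "(A, B) \<in> ?R"
    then have "(A, B) \<in> R" by simp
    note d = pairingD[OF R this]
    show "(B, A) \<in> ?R" using d(1) AB by blast
    show "A \<noteq> {}" "A \<subseteq> C - P - Q" "A \<inter> B = {}" "card A = card B"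
      by (fact d(2) sub[OF AB] d(6,7))+
  next
    fix A B A' B' assume "(A, B) \<in> ?R" "(A', B') \<in> ?R" and int: "A \<inter> A' \<noteq> {}"
    then have AB: "(A, B) \<in> R" "(A', B') \<in> R" by simp_all
    from int obtain i where i: "i \<in> A" "i \<in> A'" by blast
    show "A = A'" "B = B'" by (fact pairing_unique[OF R AB i])+
  qed
qed

text \<open>If \<open>a\<close> lies in no paired class, the structure is a pairing of
  \<open>C\<close>. Otherwise the class of \<open>a\<close> is \<open>insert a A\<close> with a
  partner \<open>B\<close> of size \<open>Suc (card A)\<close>, and deleting this pair leaves an
  arbitrary pairing of \<open>C - A - B\<close>. The map \<open>f\<close> reverses the
  deletion.\<close>

lemma card_pairings_insert:
  assumes fin: "finite C" and a: "a \<notin> C"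
  shows "card {R. pairing (insert a C) R} = card {R. pairing C R} +
    (\<Sum>(A, B) \<in> {(A, B). A \<subseteq> C \<and> B \<subseteq> C - A \<and> card B = Suc (card A)}.
       card {R. pairing (C - A - B) R})"
proof -
  define I where "I = {(A, B). A \<subseteq> C \<and> B \<subseteq> C - A \<and> card B = Suc (card A)}"
  define S where "S = Sigma I (\<lambda>(A, B). {R. pairing (C - A - B) R})"
  define f where "f = (\<lambda>((A, B), R). insert (insert a A, B) (insert (B, insert a A) R))"
  have finI: "finite I"
    unfolding I_def by (rule finite_subset[of _ "Pow C \<times> Pow C"]) (use fin in auto)
  \<comment> \<open>The pair through \<open>a\<close> is hence recognisable inside
    \<open>f y\<close>. This yields injectivity of \<open>f\<close> and keeps its image apart from
    the pairings of \<open>C\<close>.\<close>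
  have free: "a \<notin> A \<and> a \<notin> B" if "pairing D R" "D \<subseteq> C" "(A, B) \<in> R" for A B D R
    using pairingD(4,5)[OF that(1,3)] that(2) a by blast
  have inj: "inj_on f S"
  proof (rule inj_onI)
    fix y y' assume y: "y \<in> S" "y' \<in> S" "f y = f y'"
    obtain A B R A' B' R' where eq: "y = ((A, B), R)" "y' = ((A', B'), R')"
      by (metis surj_pair)
    have A: "A \<subseteq> C" "B \<subseteq> C" "A' \<subseteq> C" "B' \<subseteq> C" "A \<inter> B = {}" "A' \<inter> B' = {}"
      and R: "pairing (C - A - B) R" "pairing (C - A' - B') R'"
      using y eq by (auto simp: S_def I_def)
    have f: "insert (insert a A, B) (insert (B, insert a A) R) =
        insert (insert a A', B') (insert (B', insert a A') R')"
      using y eq by (simp add: f_def)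
    have an: "a \<notin> A" "a \<notin> A'" "a \<notin> B" "a \<notin> B'" using A a by auto
    have sub: "C - A - B \<subseteq> C" "C - A' - B' \<subseteq> C" by auto
    have notin: "(insert a A, B) \<notin> R" "(B, insert a A) \<notin> R"
      "(insert a A, B) \<notin> R'" "(B, insert a A) \<notin> R'"
      using free[OF R(1) sub(1)] free[OF R(2) sub(2)] by fast+
    have "(insert a A, B) \<in> insert (insert a A', B') (insert (B', insert a A') R')"
      unfolding f[symmetric] by simp
    \<comment> \<open>The swapped match \<open>insert a A = B'\<close> is excluded because
      \<open>a\<close> is not in \<open>B'\<close>.\<close>
    then have "insert a A = insert a A'" "B = B'"
      using notin(3) an by auto
    then have AB: "A = A'" "B = B'" using an by (simp_all add: insert_ident)
    have "R = insert (insert a A, B) (insert (B, insert a A) R) - {(insert a A, B), (B, insert a A)}"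
      using notin by simp
    also have "\<dots> = R'"
      unfolding f unfolding AB[symmetric] using notin by simp
    finally have "R = R'" .
    with eq AB show "y = y'" by simp
  qed
  have f_in: "pairing (insert a C) (f y) \<and> f y \<notin> {R. pairing C R}" if "y \<in> S" for y
  proof -
    obtain A B R where eq: "y = ((A, B), R)" by (metis surj_pair)
    have A: "A \<subseteq> C" "B \<subseteq> C" "A \<inter> B = {}" "card B = Suc (card A)" and R: "pairing (C - A - B) R"
      using that eq by (auto simp: S_def I_def)
    have "a \<notin> A" "finite A" "B \<noteq> {}" using A a fin by (auto intro: finite_subset)
    then have "pairing (insert a C) (f y)"
      unfolding f_def eq prod.case using A a R
      by (intro pairing_add) (auto intro: pairing_mono)
    moreover have "\<not> pairing C (f y)"
      using free[of C "f y" "insert a A" B] by (auto simp: f_def eq)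
    ultimately show ?thesis by simp
  qed
  have onto: "R \<in> {R. pairing C R} \<union> f ` S" if R: "pairing (insert a C) R" for R
  proof (cases "a \<in> \<Union> (Domain R)")
    case False
    then have "pairing C R" using R unfolding pairing_def by blast
    then show ?thesis by simp
  next
    case True
    then obtain P Q where PQ: "(P, Q) \<in> R" "a \<in> P" by blast
    define A where "A = P - {a}"
    have P: "P = insert a A" "a \<notin> A" using PQ by (auto simp: A_def)
    note p = pairingD[OF R PQ(1)]
    have Q: "Q \<subseteq> C" "a \<notin> Q" "A \<subseteq> C" "Q \<subseteq> C - A" using p P PQ by auto
    have "finite A" using Q fin by (auto intro: finite_subset)
    then have "card Q = Suc (card A)" using p(7) P by simp
    moreover have "insert a C - P - Q = C - A - Q" using P a by auto
    ultimately have "((A, Q), R - {(P, Q), (Q, P)}) \<in> S"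
      using pairing_remove[OF R PQ(1)] Q by (auto simp: S_def I_def)
    moreover have "R = f ((A, Q), R - {(P, Q), (Q, P)})"
      using PQ p(1) by (auto simp: f_def P(1)[symmetric])
    ultimately show ?thesis by blast
  qed
  have "{R. pairing (insert a C) R} = {R. pairing C R} \<union> f ` S"
    using onto f_in pairing_mono[of C _ "insert a C"] by blast
  moreover have "finite S"
    unfolding S_def using finI fin by (intro finite_SigmaI) (auto intro: finite_pairings)
  ultimately have "card {R. pairing (insert a C) R} = card {R. pairing C R} + card (f ` S)"
    using f_in finite_pairings[OF fin] by (auto intro!: card_Un_disjoint)
  also have "card (f ` S) = (\<Sum>(A, B)\<in>I. card {R. pairing (C - A - B) R})"
    unfolding card_image[OF inj] unfolding S_def using finI fin
    by (subst card_SigmaI) (auto intro: finite_pairings simp: case_prod_unfold)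
  finally show ?thesis unfolding I_def .
qed

section \<open>Sums over subsets and disjoint pairs as binomial sums\<close>

lemma sum_over_subsets_card:
  fixes g :: "nat \<Rightarrow> 'b::comm_semiring_1"
  assumes "finite C"
  shows "(\<Sum>A\<in>Pow C. g (card A)) = (\<Sum>k\<le>card C. of_nat (card C choose k) * g k)"
proof -
  have "(\<Sum>A\<in>Pow C. g (card A)) = (\<Sum>k\<le>card C. \<Sum>A\<in>{A\<in>Pow C. card A = k}. g (card A))"
    using assms by (intro sum.group[symmetric]) (auto intro: card_mono)
  also have "\<dots> = (\<Sum>k\<le>card C. of_nat (card C choose k) * g k)"
    using assms by (intro sum.cong) (simp_all add: n_subsets)
  finally show ?thesis .
qed

text \<open>With n = \<open>card C\<close>, choose \<open>A\<close> of size k, then \<open>B\<close>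
  of size k + 1 among the n - k points left; this leaves n - (2k + 1) points. For 2k + 1 > n the
  second binomial coefficient is 0, so truncated subtraction does no harm.\<close>

lemma sum_over_disjoint_pairs:
  fixes g :: "nat \<Rightarrow> 'b::comm_semiring_1"
  assumes fin: "finite C"
  shows "(\<Sum>(A, B) \<in> {(A, B). A \<subseteq> C \<and> B \<subseteq> C - A \<and> card B = Suc (card A)}. g (card (C - A - B)))
    = (\<Sum>k\<le>card C. of_nat ((card C choose k) * (card C - k choose Suc k)) * g (card C - (2 * k + 1)))"
proof -
  have set: "{(A, B). A \<subseteq> C \<and> B \<subseteq> C - A \<and> card B = Suc (card A)} =
      Sigma (Pow C) (\<lambda>A. {B. B \<subseteq> C - A \<and> card B = Suc (card A)})"
    by auto
  have inner: "(\<Sum>B | B \<subseteq> C - A \<and> card B = Suc (card A). g (card (C - A - B))) =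
     of_nat (card C - card A choose Suc (card A)) * g (card C - (2 * card A + 1))" if "A \<in> Pow C" for A
  proof -
    have finA: "finite A" using that fin by (auto intro: finite_subset)
    have "card (C - A - B) = card C - (2 * card A + 1)" if "B \<subseteq> C - A" "card B = Suc (card A)" for B
    proof -
      have "finite B" using that fin by (auto intro: finite_subset)
      then show ?thesis using that \<open>A \<in> Pow C\<close> finA by (simp add: card_Diff_subset)
    qed
    then have "(\<Sum>B | B \<subseteq> C - A \<and> card B = Suc (card A). g (card (C - A - B))) =
      (\<Sum>B | B \<subseteq> C - A \<and> card B = Suc (card A). g (card C - (2 * card A + 1)))"
      by (intro sum.cong) auto
    also have "\<dots> = of_nat (card C - card A choose Suc (card A)) * g (card C - (2 * card A + 1))"
      using fin that finA by (simp add: n_subsets card_Diff_subset)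
    finally show ?thesis .
  qed
  have "(\<Sum>(A, B) \<in> {(A, B). A \<subseteq> C \<and> B \<subseteq> C - A \<and> card B = Suc (card A)}. g (card (C - A - B))) =
    (\<Sum>A\<in>Pow C. of_nat (card C - card A choose Suc (card A)) * g (card C - (2 * card A + 1)))"
    unfolding set using fin by (subst sum.Sigma[symmetric]) (simp_all add: inner)
  also have "\<dots> = (\<Sum>k\<le>card C.
      of_nat ((card C choose k) * (card C - k choose Suc k)) * g (card C - (2 * k + 1)))"
    by (subst sum_over_subsets_card[OF fin,
         of "\<lambda>k. of_nat (card C - k choose Suc k) * g (card C - (2 * k + 1))"]) (simp add: mult.assoc)
  finally show ?thesis .
qed

text \<open>The factor (n - k)! cancels between the two binomial coefficients, leaving a multinomial
  coefficient.\<close>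

lemma choose_choose_fact:
  assumes "2 * k + 1 \<le> n"
  shows "real ((n choose k) * (n - k choose Suc k)) =
    fact n / (fact k * fact (Suc k) * fact (n - (2 * k + 1)))"
proof -
  have "n - k - Suc k = n - (2 * k + 1)" using assms by simp
  then show ?thesis
    using assms binomial_fact[of k n, where 'a = real] binomial_fact[of "Suc k" "n - k", where 'a = real]
    by (simp del: fact_Suc)
qed

section \<open>The exponential series and its differential equation\<close>

definition even_egf :: "real fps" where
  "even_egf = fps_exp (1::real) oo
     (fps_const (1/2) * (bessel_I0 oo (fps_const 2 * fps_X)) - fps_const (1/2) + fps_X)"

text \<open>By the chain rule it remains to differentiate the exponent. The term x^(2k+2) / (2
  ((k+1)!)^2) of I_0(2x)/2 contributes x^(2k+1) / (k! (k+1)!), and the summand x contributes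
  1.\<close>

lemma fps_deriv_even_egf:
  "fps_deriv even_egf = even_egf * (1 + Abs_fps (\<lambda>j.
     if odd j then 1 / (fact (j div 2) * fact (Suc (j div 2))) else 0))" (is "_ = _ * (1 + ?G)")
proof -
  define B :: "real fps" where "B = bessel_I0 oo (fps_const 2 * fps_X)"
  have B_nth: "B $ k = (if even k then 1 / (fact (k div 2))\<^sup>2 else 0)" for k
    unfolding B_def by (rule bessel_I0_double_nth)
  let ?H = "fps_const (1/2) * B - fps_const (1/2) + fps_X"
  have "fps_deriv even_egf = even_egf * fps_deriv ?H"
    \<comment> \<open>The chain rule needs an inner series without constant term; here it is 1/2 -
      1/2 = 0.\<close>
    unfolding even_egf_def B_def[symmetric] by (subst fps_compose_deriv) (simp_all add: B_nth)
  also have "fps_deriv ?H = 1 + ?G"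
  proof (rule fps_ext)
    fix j
    show "fps_deriv ?H $ j = (1 + ?G) $ j"
    proof (cases "odd j")
      case True
      then obtain k where "j = 2 * k + 1" by (rule oddE)
      then show ?thesis
        by (simp add: B_nth power2_eq_square divide_simps)
    qed (auto simp: B_nth)
  qed
  finally show ?thesis .
qed

lemma even_egf_nth_0: "even_egf $ 0 = 1"
  by (simp add: even_egf_def)

text \<open>Substituting j = 2k + 1 and padding with zeros up to n gives the index range of the
  combinatorial sum.\<close>

lemma sum_odd_reindex:
  fixes h :: "nat \<Rightarrow> 'b::comm_monoid_add"
  shows "(\<Sum>j\<le>n. if odd j then h j else 0) = (\<Sum>k\<le>n. if 2 * k + 1 \<le> n then h (2 * k + 1) else 0)"
proof -
  have "(\<Sum>j\<le>n. if odd j then h j else 0) = (\<Sum>j | j \<le> n \<and> odd j. h j)"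
    by (simp add: sum.inter_filter[symmetric])
  also have "\<dots> = (\<Sum>k | k \<le> n \<and> 2 * k + 1 \<le> n. h (2 * k + 1))"
    by (rule sum.reindex_bij_witness[of _ "\<lambda>k. 2 * k + 1" "\<lambda>j. j div 2"]) auto
  also have "\<dots> = (\<Sum>k\<le>n. if 2 * k + 1 \<le> n then h (2 * k + 1) else 0)"
    by (simp add: sum.inter_filter[symmetric])
  finally show ?thesis .
qed

text \<open>This compares coefficients of x^n in the differential equation and multiplies by n!, in
  the same shape as the recurrence for pairings.\<close>

lemma even_egf_recurrence:
  "fact (Suc n) * even_egf $ Suc n = fact n * even_egf $ n +
    (\<Sum>k\<le>n. real ((n choose k) * (n - k choose Suc k)) *
       (fact (n - (2 * k + 1)) * even_egf $ (n - (2 * k + 1))))"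
proof -
  let ?w = "\<lambda>j. 1 / (fact (j div 2) * fact (Suc (j div 2))) :: real"
  have "fact (Suc n) * even_egf $ Suc n = fact n * fps_deriv even_egf $ n"
    by (simp add: algebra_simps)
  also have "fps_deriv even_egf $ n =
      even_egf $ n + (\<Sum>j\<le>n. if odd j then ?w j * even_egf $ (n - j) else 0)"
    unfolding fps_deriv_even_egf distrib_left fps_add_nth
    by (subst mult.commute[of _ "Abs_fps _"])
      (auto simp: fps_mult_nth atLeast0AtMost intro!: sum.cong)
  also have "fact n * \<dots> = fact n * even_egf $ n + (\<Sum>k\<le>n. fact n *
      (if 2 * k + 1 \<le> n then ?w (2 * k + 1) * even_egf $ (n - (2 * k + 1)) else 0))"
    by (simp only: sum_odd_reindex distrib_left sum_distrib_left)
  also have "(\<Sum>k\<le>n. fact n * (if 2 * k + 1 \<le> n then ?w (2 * k + 1) * even_egf $ (n - (2 * k + 1)) else 0)) =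
    (\<Sum>k\<le>n. real ((n choose k) * (n - k choose Suc k)) *
       (fact (n - (2 * k + 1)) * even_egf $ (n - (2 * k + 1))))"
  proof (rule sum.cong[OF refl])
    fix k
    show "fact n * (if 2 * k + 1 \<le> n then ?w (2 * k + 1) * even_egf $ (n - (2 * k + 1)) else 0) =
      real ((n choose k) * (n - k choose Suc k)) * (fact (n - (2 * k + 1)) * even_egf $ (n - (2 * k + 1)))"
    proof (cases "2 * k + 1 \<le> n")
      case True
      then show ?thesis by (subst choose_choose_fact) (simp_all del: fact_Suc)
    next
      case False
      \<comment> \<open>Here k + 1 > n - k, so the binomial coefficient vanishes like the padded
        term.\<close>
      then have "n - k choose Suc k = 0" by (intro binomial_eq_0) simp
      with False show ?thesis by simp
    qed
  qed
  finally show ?thesis .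
qed

section \<open>Comparison of the count with the coefficients\<close>

text \<open>Both sides satisfy the same recurrence and equal 1 for the empty set. The induction is
  strong because removing a pair may shrink the set by any odd number of further points.\<close>

lemma card_pairings:
  assumes "finite C"
  shows "real (card {R. pairing C R}) = fact (card C) * even_egf $ card C"
  using assms
proof (induction "card C" arbitrary: C rule: less_induct)
  case less
  show ?case
  proof (cases "C = {}")
    case True
    have "{R. pairing ({} :: 'a set) R} = {{}}" by (auto simp: pairing_def)
    with True show ?thesis by (simp add: even_egf_nth_0)
  next
    case False
    then obtain a D where C: "C = insert a D" "a \<notin> D" by (meson Set.set_insert ex_in_conv)
    with less have fin: "finite D" and card: "card C = Suc (card D)" by auto
    \<comment> \<open>Every subset of \<open>D\<close> is smaller than \<open>C\<close>, which
      covers \<open>D\<close> itself as well as all sets \<open>D - A - B\<close>.\<close>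
    have IH: "real (card {R. pairing B R}) = fact (card B) * even_egf $ card B" if "B \<subseteq> D" for B
      using that fin card by (intro less) (auto intro: finite_subset simp: less_Suc_eq_le card_mono)
    have "real (card {R. pairing C R}) = real (card {R. pairing D R}) +
      (\<Sum>(A, B) \<in> {(A, B). A \<subseteq> D \<and> B \<subseteq> D - A \<and> card B = Suc (card A)}.
         fact (card (D - A - B)) * even_egf $ card (D - A - B))"
      unfolding C(1) card_pairings_insert[OF fin C(2)] of_nat_add of_nat_sum
      by (intro arg_cong2[where f = plus] refl sum.cong) (auto intro: IH)
    also have "\<dots> = fact (card C) * even_egf $ card C"
      unfolding sum_over_disjoint_pairs[OF fin, of "\<lambda>m. fact m * even_egf $ m"] card
        even_egf_recurrence IH[OF subset_refl] ..
    finally show ?thesis .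
  qed
qed

theorem proposition7p16:
  "egf num_evenly_tagged =
     fps_exp (1::real) oo
       (fps_const (1/2) * (bessel_I0 oo (fps_const 2 * fps_X)) - fps_const (1/2) + fps_X)"
proof -
  have "egf num_evenly_tagged $ n = even_egf $ n" for n
    using card_pairings[of "{1..n}"] by (simp add: egf_def num_evenly_tagged_eq)
  then show ?thesis
    unfolding even_egf_def[symmetric] by (rule fps_ext)
qed

end
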